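(* Let $R$ be a commutative ring with identity that is not an integral domain. Then $\mathbb{AG}(R)$ has ACC (respectively, DCC) on vertices if and only if $R$ is a Noetherian (respectively, an Artinian) ring.
   Context: An ideal $I$ of a commutative ring $R$ is called an annihilating-ideal if there exists a nonzero ideal $J$ of $R$ with $IJ=(0)$. $\mathbb{A}(R)$ denotes the set of all annihilating-ideals of $R$, and $\mathbb{A}(R)^*=\mathbb{A}(R)\setminus\{(0)\}$. The annihilating-ideal graph $\mathbb{AG}(R)$ is the undirected graph with vertex set $\mathbb{A}(R)^*$ in which two distinct vertices $I,J$ are adjacent if and only if $IJ=(0)$. $\mathbb{AG}(R)$ is said to have ACC (resp. DCC) on vertices if the set $\mathbb{A}(R)^*$, ordered by inclusion, satisfies the ascending (resp. descending) chain condition. *)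

theory Defs
  imports "HOL-Algebra.Ideal_Product" "HOL-Algebra.Ring_Divisibility" "Graph_Theory.Pair_Digraph"
begin

definition acc_on :: "'a::order set \<Rightarrow> bool" where
  "acc_on A \<longleftrightarrow>
    (\<forall>f::nat \<Rightarrow> 'a. (\<forall>n. f n \<in> A) \<longrightarrow> incseq f \<longrightarrow> (\<exists>N. \<forall>n\<ge>N. f n = f N))"

definition dcc_on :: "'a::order set \<Rightarrow> bool" where
  "dcc_on A \<longleftrightarrow>
    (\<forall>f::nat \<Rightarrow> 'a. (\<forall>n. f n \<in> A) \<longrightarrow> decseq f \<longrightarrow> (\<exists>N. \<forall>n\<ge>N. f n = f N))"

text \<open>
  The locale \<^locale>\<open>ideal\<close> is about two-sided ideals, so the descending chain condition
  below is the usual Artinian property only for commutative rings; hence the base \<^locale>\<open>cring\<close>.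
\<close>

locale artinian_ring = cring +
  assumes dcc_on_ideals: "dcc_on {I. ideal I R}"

definition annihilating_ideals :: "('a, 'b) ring_scheme \<Rightarrow> 'a set set" where
  "annihilating_ideals R =
    {I. ideal I R \<and> (\<exists>J. ideal J R \<and> J \<noteq> {\<zero>\<^bsub>R\<^esub>} \<and> I \<cdot>\<^bsub>R\<^esub> J = {\<zero>\<^bsub>R\<^esub>})}"

text \<open>
  The undirected graph is encoded as a symmetric loop-free digraph (\<^locale>\<open>pair_bidirected_digraph\<close>):
  each edge is a pair of opposite arcs. The locale \<^locale>\<open>pair_graph\<close> is not used because it requires finitely many vertices.
\<close>

definition annihilating_ideal_graph :: "('a, 'b) ring_scheme \<Rightarrow> 'a set pair_pre_digraph" where
  "annihilating_ideal_graph R =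
    (let V = annihilating_ideals R - {{\<zero>\<^bsub>R\<^esub>}} in
      \<lparr> pverts = V,
        parcs = {(I, J). I \<in> V \<and> J \<in> V \<and> I \<noteq> J \<and> I \<cdot>\<^bsub>R\<^esub> J = {\<zero>\<^bsub>R\<^esub>}} \<rparr>)"

definition acc_on_vertices :: "'a::order pair_pre_digraph \<Rightarrow> bool" where
  "acc_on_vertices G \<longleftrightarrow> acc_on (pverts G)"

definition dcc_on_vertices :: "'a::order pair_pre_digraph \<Rightarrow> bool" where
  "dcc_on_vertices G \<longleftrightarrow> dcc_on (pverts G)"

lemma (in cring) annihilating_ideal_graph_bidirected:
  "pair_bidirected_digraph (annihilating_ideal_graph R)"
proof -
  let ?G = "annihilating_ideal_graph R"
  have swap: "(J, I) \<in> parcs ?G" if IJ: "(I, J) \<in> parcs ?G" for I J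
  proof -
    have "ideal I R" "ideal J R"
      using IJ by (simp_all add: annihilating_ideal_graph_def annihilating_ideals_def Let_def)
    then have "J \<cdot> I = I \<cdot> J"
      by (rule ideal_prod_commute[rotated])
    with IJ show ?thesis
      by (auto simp: annihilating_ideal_graph_def Let_def)
  qed
  have "sym (parcs ?G)"
    by (rule symI) (rule swap)
  then have "symmetric (with_proj ?G)"
    by (simp add: symmetric_def)
  moreover have "fst e \<in> pverts ?G \<and> snd e \<in> pverts ?G \<and> fst e \<noteq> snd e" if "e \<in> parcs ?G" for e
    using that by (cases e) (simp add: annihilating_ideal_graph_def Let_def)
  ultimately show ?thesis
    by unfold_locales blast+
qed

end

(*
  If x y = 0 with x and y nonzero, then I \<mapsto> (I \<inter> Ann x, x I) sends ideals to pairs of annihilating ideals: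
  x kills the first component and y the second. The map is monotone, and it is injective on
  comparable ideals (it is the decomposition of I along 0 \<rightarrow> Ann x \<rightarrow> R \<rightarrow> x R \<rightarrow> 0), so chain conditions
  on annihilating ideals pass to all ideals.
*)
theory Submission
  imports Defs
begin

section \<open>Chain conditions on ordered sets\<close>

lemma acc_on_subset: "acc_on B \<Longrightarrow> A \<subseteq> B \<Longrightarrow> acc_on A"
  unfolding acc_on_def by blast

lemma dcc_on_subset: "dcc_on B \<Longrightarrow> A \<subseteq> B \<Longrightarrow> dcc_on A"
  unfolding dcc_on_def by blast

text \<open>An ascending sequence that has left the least element never returns to it, so a tail of
  it lies in \<open>A - {z}\<close>. This compares the vertices of the graph with all annihilating
  ideals, \<open>z\<close> being the zero ideal.\<close>

lemma acc_on_remove_least: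
  assumes acc: "acc_on (A - {z})" and least: "\<And>a. a \<in> A \<Longrightarrow> z \<le> a"
  shows "acc_on A"
  unfolding acc_on_def
proof (intro allI impI)
  fix f :: "nat \<Rightarrow> 'a"
  assume f: "\<forall>n. f n \<in> A" "incseq f"
  show "\<exists>N. \<forall>n\<ge>N. f n = f N"
  proof (cases "\<forall>n. f n = z")
    case False
    then obtain k where k: "f k \<noteq> z"
      by blast
    \<comment> \<open>Otherwise \<open>f k \<le> f (n + k) = z\<close>, and minimality of
      \<open>z\<close> would force \<open>f k = z\<close>.\<close>
    have "f (n + k) \<noteq> z" for n
      using k f incseqD[OF f(2), of k "n + k"] least[of "f k"] by (metis antisym le_add2)
    moreover have "incseq (\<lambda>n. f (n + k))"
      using f(2) by (simp add: incseq_def)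
    ultimately obtain N where N: "\<forall>n\<ge>N. f (n + k) = f (N + k)"
      using acc f(1) unfolding acc_on_def by (metis (mono_tags, lifting) DiffI singletonD)
    have "f n = f (N + k)" if "n \<ge> N + k" for n
      using N[rule_format, of "n - k"] that by simp
    then show ?thesis
      by blast
  qed auto
qed

text \<open>A descending sequence that reaches the least element stays there; one that never does
  lies entirely in \<open>A - {z}\<close>.\<close>

lemma dcc_on_remove_least:
  assumes dcc: "dcc_on (A - {z})" and least: "\<And>a. a \<in> A \<Longrightarrow> z \<le> a"
  shows "dcc_on A"
  unfolding dcc_on_def
proof (intro allI impI)
  fix f :: "nat \<Rightarrow> 'a"
  assume f: "\<forall>n. f n \<in> A" "decseq f"
  show "\<exists>N. \<forall>n\<ge>N. f n = f N"
  proof (cases "\<exists>k. f k = z")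
    case True
    then obtain k where "f k = z"
      by blast
    then have "\<forall>n\<ge>k. f n = f k"
      using f least decseqD[OF f(2)] by (metis antisym)
    then show ?thesis
      by blast
  next
    case False
    then show ?thesis
      using dcc f unfolding dcc_on_def by simp
  qed
qed

text \<open>Both image sequences are ascending in \<open>B\<close>, hence eventually constant; from
  then on the terms are comparable and have equal images. Injectivity is asked for on comparable
  pairs only, because different incomparable ideals can share both components in the intended
  application.\<close>

lemma acc_on_jointly_injective:
  fixes A :: "'a::order set" and B :: "'b::order set"
  assumes acc: "acc_on B"
    and g: "\<And>a. a \<in> A \<Longrightarrow> g a \<in> B" "mono_on A g"
    and h: "\<And>a. a \<in> A \<Longrightarrow> h a \<in> B" "mono_on A h"
    and inj: "\<And>a b. a \<in> A \<Longrightarrow> b \<in> A \<Longrightarrow> a \<le> b \<Longrightarrow> g a = g b \<Longrightarrow> h a = h b \<Longrightarrow> a = b"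
  shows "acc_on A"
  unfolding acc_on_def
proof (intro allI impI)
  fix f :: "nat \<Rightarrow> 'a"
  assume f: "\<forall>n. f n \<in> A" "incseq f"
  have stable: "\<exists>N. \<forall>n\<ge>N. k (f n) = k (f N)"
    if "\<And>a. a \<in> A \<Longrightarrow> k a \<in> B" "mono_on A k" for k
  proof -
    have "incseq (\<lambda>n. k (f n))"
      using that(2) f by (simp add: incseq_def mono_on_def)
    then show ?thesis
      using acc that(1) f(1) unfolding acc_on_def by (metis (mono_tags, lifting))
  qed
  obtain N M where N: "\<forall>n\<ge>N. g (f n) = g (f N)" and M: "\<forall>n\<ge>M. h (f n) = h (f M)"
    using stable[OF g] stable[OF h] by blast
  \<comment> \<open>From the larger of the two indices on, both image sequences are
    constant.\<close>
  have "f n = f (max N M)" if "n \<ge> max N M" for n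
  proof (rule inj[symmetric])
    show "f (max N M) \<le> f n"
      using that by (rule incseqD[OF f(2)])
    show "g (f (max N M)) = g (f n)" "h (f (max N M)) = h (f n)"
      using that N M by (metis max.bounded_iff max.cobounded1 max.cobounded2)+
  qed (use f in auto)
  then show "\<exists>N. \<forall>n\<ge>N. f n = f N"
    by blast
qed

text \<open>The argument is dual to the ascending one: the later term is now the smaller one, so
  \<open>inj\<close> is applied in the opposite direction.\<close>

lemma dcc_on_jointly_injective:
  fixes A :: "'a::order set" and B :: "'b::order set"
  assumes dcc: "dcc_on B"
    and g: "\<And>a. a \<in> A \<Longrightarrow> g a \<in> B" "mono_on A g"
    and h: "\<And>a. a \<in> A \<Longrightarrow> h a \<in> B" "mono_on A h"
    and inj: "\<And>a b. a \<in> A \<Longrightarrow> b \<in> A \<Longrightarrow> a \<le> b \<Longrightarrow> g a = g b \<Longrightarrow> h a = h b \<Longrightarrow> a = b"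
  shows "dcc_on A"
  unfolding dcc_on_def
proof (intro allI impI)
  fix f :: "nat \<Rightarrow> 'a"
  assume f: "\<forall>n. f n \<in> A" "decseq f"
  have stable: "\<exists>N. \<forall>n\<ge>N. k (f n) = k (f N)"
    if "\<And>a. a \<in> A \<Longrightarrow> k a \<in> B" "mono_on A k" for k
  proof -
    have "decseq (\<lambda>n. k (f n))"
      using that(2) f by (simp add: decseq_def mono_on_def)
    then show ?thesis
      using dcc that(1) f(1) unfolding dcc_on_def by (metis (mono_tags, lifting))
  qed
  obtain N M where N: "\<forall>n\<ge>N. g (f n) = g (f N)" and M: "\<forall>n\<ge>M. h (f n) = h (f M)"
    using stable[OF g] stable[OF h] by blast
  have "f n = f (max N M)" if "n \<ge> max N M" for n
  proof (rule inj)
    show "f n \<le> f (max N M)"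
      using that by (rule decseqD[OF f(2)])
    show "g (f n) = g (f (max N M))" "h (f n) = h (f (max N M))"
      using that N M by (metis max.bounded_iff max.cobounded1 max.cobounded2)+
  qed (use f in auto)
  then show "\<exists>N. \<forall>n\<ge>N. f n = f N"
    by blast
qed

section \<open>Noetherian rings and ascending sequences of ideals\<close>

lemma (in noetherian_ring) acc_on_ideals: "acc_on {I. ideal I R}"
  unfolding acc_on_def
proof (intro allI impI)
  fix f :: "nat \<Rightarrow> 'a set"
  assume f: "\<forall>n. f n \<in> {I. ideal I R}" "incseq f"
  have "subset.chain {I. ideal I R} (range f)"
    unfolding pred_on.chain_def
  proof (intro conjI ballI)
    show "range f \<subseteq> {I. ideal I R}"
      using f(1) by blast
    fix I J assume "I \<in> range f" "J \<in> range f"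
    then obtain i j where "I = f i" "J = f j"
      by blast
    then show "(\<subset>)\<^sup>=\<^sup>= I J \<or> (\<subset>)\<^sup>=\<^sup>= J I"
      using incseqD[OF f(2)] by (cases i j rule: le_cases) auto
  qed
  \<comment> \<open>In a Noetherian ring a nonempty chain of ideals contains its own union. The
    sequence is constant from the index at which that union occurs.\<close>
  then obtain N where N: "\<Union>(range f) = f N"
    using ideal_chain_is_trivial[of "range f"] by auto
  have "f n = f N" if "n \<ge> N" for n
    using N incseqD[OF f(2) that] by blast
  then show "\<exists>N. \<forall>n\<ge>N. f n = f N"
    by blast
qed

text \<open>It suffices that every nonempty chain of ideals contains its union. A chain that misses
  its union has no largest member, so dependent choice extracts a strictly ascending sequence from
  it, against the chain condition.\<close>

lemma (in ring) noetherian_ring_if_acc_on_ideals: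
  assumes acc: "acc_on {I. ideal I R}"
  shows "noetherian_ring R"
proof (rule trivial_ideal_chain_imp_noetherian, rule ccontr)
  fix C assume C: "C \<noteq> {}" "subset.chain {I. ideal I R} C" and not_in: "\<Union>C \<notin> C"
  have bigger: "\<exists>J. J \<in> C \<and> I \<subset> J" if "I \<in> C" for I
  proof (rule ccontr)
    assume max: "\<nexists>J. J \<in> C \<and> I \<subset> J"
    have "J \<subseteq> I" if J: "J \<in> C" for J
    proof -
      have "I \<subseteq> J \<or> J \<subseteq> I"
        using subset_chain_def[of "{I. ideal I R}" C] C(2) \<open>I \<in> C\<close> J by simp
      with max J show ?thesis
        by auto
    qed
    then have "\<Union>C = I"
      using \<open>I \<in> C\<close> by blast
    with \<open>I \<in> C\<close> not_in show False
      by blast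
  qed
  have "\<exists>f. \<forall>n. f n \<in> C \<and> f n \<subset> f (Suc n)"
    by (rule dependent_nat_choice) (use C(1) bigger in auto)
  then obtain f where f: "\<forall>n::nat. f n \<in> C \<and> f n \<subset> f (Suc n)"
    by (rule exE)
  have inc: "incseq f"
    by (rule incseq_SucI) (rule psubset_imp_subset[OF conjunct2[OF spec[OF f]]])
  have ideals: "\<forall>n. f n \<in> {I. ideal I R}"
    using C(2) f by (auto simp only: subset_chain_def)
  obtain N where N: "\<forall>n\<ge>N. f n = f N"
    using acc[unfolded acc_on_def, THEN spec, THEN mp, THEN mp, OF ideals inc] by (rule exE)
  have "f (Suc N) = f N"
    by (rule N[rule_format]) simp
  with spec[OF f, of N] show False
    by simp
qed

section \<open>Ideals attached to a zero divisor\<close>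

context cring
begin

lemma ideal_element_annihilator:
  assumes "x \<in> carrier R"
  shows "ideal {z \<in> carrier R. x \<otimes> z = \<zero>} R"
proof (rule idealI[OF ring_axioms])
  show "subgroup {z \<in> carrier R. x \<otimes> z = \<zero>} (add_monoid R)"
    using assms by (intro add.subgroupI) (auto simp: r_distr r_minus simp flip: a_inv_def)
next
  fix a r assume a: "a \<in> {z \<in> carrier R. x \<otimes> z = \<zero>}" and r: "r \<in> carrier R"
  then show "a \<otimes> r \<in> {z \<in> carrier R. x \<otimes> z = \<zero>}"
    using assms by (simp flip: m_assoc)
  then show "r \<otimes> a \<in> {z \<in> carrier R. x \<otimes> z = \<zero>}"
    using a r by (simp add: m_comm)
qed

lemma ideal_mult_image:
  assumes "ideal I R" and x: "x \<in> carrier R"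
  shows "ideal ((\<lambda>z. x \<otimes> z) ` I) R"
proof -
  interpret I: ideal I R by fact
  have r: "x \<otimes> a \<otimes> r \<in> (\<lambda>z. x \<otimes> z) ` I" if "a \<in> I" "r \<in> carrier R" for a r
  proof (rule image_eqI)
    show "x \<otimes> a \<otimes> r = x \<otimes> (a \<otimes> r)"
      using x that I.Icarr by (simp add: m_assoc)
  qed (rule I.I_r_closed[OF that])
  show ?thesis
  proof (rule idealI[OF ring_axioms])
    show "subgroup ((\<lambda>z. x \<otimes> z) ` I) (add_monoid R)"
    proof (rule add.subgroupI)
      show "(\<lambda>z. x \<otimes> z) ` I \<subseteq> carrier R" "(\<lambda>z. x \<otimes> z) ` I \<noteq> {}"
        using x I.Icarr I.zero_closed by (auto simp del: I.zero_closed)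
    next
      fix a assume "a \<in> (\<lambda>z. x \<otimes> z) ` I"
      then obtain u where u: "u \<in> I" "a = x \<otimes> u"
        by blast
      then have "\<ominus> a = x \<otimes> (\<ominus> u)"
        using x I.Icarr by (simp add: r_minus)
      then show "\<ominus> a \<in> (\<lambda>z. x \<otimes> z) ` I"
        using u I.a_inv_closed by auto
    next
      fix a b assume "a \<in> (\<lambda>z. x \<otimes> z) ` I" "b \<in> (\<lambda>z. x \<otimes> z) ` I"
      then obtain u v where uv: "u \<in> I" "v \<in> I" "a = x \<otimes> u" "b = x \<otimes> v"
        by blast
      then have "a \<oplus> b = x \<otimes> (u \<oplus> v)"
        using x I.Icarr by (simp add: r_distr)
      then show "a \<oplus> b \<in> (\<lambda>z. x \<otimes> z) ` I"
        using uv I.a_closed by auto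
    qed
  next
    fix a s assume "a \<in> (\<lambda>z. x \<otimes> z) ` I" and s: "s \<in> carrier R"
    then obtain u where u: "u \<in> I" "a = x \<otimes> u"
      by blast
    then show "a \<otimes> s \<in> (\<lambda>z. x \<otimes> z) ` I"
      using r s by simp
    then show "s \<otimes> a \<in> (\<lambda>z. x \<otimes> z) ` I"
      using u s x I.Icarr by (simp add: m_comm)
  qed
qed

text \<open>One nonzero element that kills \<open>I\<close> suffices: the principal ideal
  \<open>PIdl y\<close> is the nonzero witness, since \<open>i (r y) = r (i y) = 0\<close> by
  commutativity.\<close>

lemma annihilating_idealsI:
  assumes I: "ideal I R" and y: "y \<in> carrier R" "y \<noteq> \<zero>"
    and ann: "\<And>i. i \<in> I \<Longrightarrow> i \<otimes> y = \<zero>"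
  shows "I \<in> annihilating_ideals R"
proof -
  interpret I: ideal I R by fact
  have J: "ideal (PIdl y) R"
    using y by (simp add: cgenideal_ideal)
  have "I \<cdot> (PIdl y) \<subseteq> {\<zero>}"
  proof
    fix s assume "s \<in> I \<cdot> (PIdl y)"
    \<comment> \<open>Induction over the generation of the product ideal: the products
      \<open>i \<otimes> j\<close> vanish, and sums of zeros are zero.\<close>
    then show "s \<in> {\<zero>}"
    proof induction
      case (prod i j)
      then obtain r where "r \<in> carrier R" "j = r \<otimes> y"
        by (auto simp: cgenideal_def)
      then have "i \<otimes> j = r \<otimes> (i \<otimes> y)"
        using prod I.Icarr y by (simp add: m_lcomm)
      then show ?case
        using prod ann \<open>r \<in> carrier R\<close> by simp
    qed simp
  qed
  moreover have "\<zero> \<in> I \<cdot> (PIdl y)"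
    using ideal_prod_is_ideal[OF I J] by (simp add: additive_subgroup.zero_closed ideal.axioms(1))
  moreover have "PIdl y \<noteq> {\<zero>}"
    using cgenideal_self[OF y(1)] y(2) by blast
  ultimately show ?thesis
    using I J unfolding annihilating_ideals_def by blast
qed

text \<open>This is the short five lemma for the inclusion of \<open>I\<close> in \<open>J\<close>,
  applied to the exact sequences given by multiplication by \<open>x\<close>. Elementwise,
  \<open>z\<close> in \<open>J\<close> is corrected by some \<open>w\<close> in \<open>I\<close>
  with the same multiple, and the difference lies in the annihilator of \<open>x\<close>.\<close>

lemma ideal_eq_if_annihilator_part_and_multiple_eq:
  assumes "ideal I R" "ideal J R" "I \<subseteq> J" and x: "x \<in> carrier R"
    and ann: "I \<inter> {z \<in> carrier R. x \<otimes> z = \<zero>} = J \<inter> {z \<in> carrier R. x \<otimes> z = \<zero>}"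
    and mult: "(\<lambda>z. x \<otimes> z) ` I = (\<lambda>z. x \<otimes> z) ` J"
  shows "I = J"
proof
  interpret I: ideal I R by fact
  interpret J: ideal J R by fact
  show "J \<subseteq> I"
  proof
    fix z assume z: "z \<in> J"
    then obtain w where w: "w \<in> I" "x \<otimes> z = x \<otimes> w"
      using mult by (metis imageE imageI)
    have carr: "z \<in> carrier R" "w \<in> carrier R"
      using z w I.Icarr J.Icarr by auto
    \<comment> \<open>The inclusion \<open>I \<subseteq> J\<close> enters here: it places
      \<open>w\<close> in \<open>J\<close>.\<close>
    have "z \<ominus> w \<in> J"
      using z w \<open>I \<subseteq> J\<close> by (auto simp: minus_eq intro: J.a_closed J.a_inv_closed)
    moreover have "x \<otimes> (z \<ominus> w) = \<zero>"
      using x carr w(2) by (simp add: minus_eq r_distr r_minus r_neg)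
    ultimately have "z \<ominus> w \<in> I"
      using ann carr by blast
    then have "(z \<ominus> w) \<oplus> w \<in> I"
      using w(1) by (rule I.a_closed)
    then show "z \<in> I"
      using carr by (simp add: minus_eq a_assoc l_neg)
  qed
qed fact

lemma chain_conditions_on_ideals_if_not_domain:
  assumes "\<not> domain R"
  shows "acc_on (annihilating_ideals R) \<Longrightarrow> acc_on {I. ideal I R}"
    and "dcc_on (annihilating_ideals R) \<Longrightarrow> dcc_on {I. ideal I R}"
proof -
  \<comment> \<open>Both implications are proved together, as they share the case split and the two
    maps.\<close>
  have "(acc_on (annihilating_ideals R) \<longrightarrow> acc_on {I. ideal I R}) \<and>
        (dcc_on (annihilating_ideals R) \<longrightarrow> dcc_on {I. ideal I R})"
  proof (cases "\<one> = \<zero>")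
    \<comment> \<open>The zero ring also fails to be a domain, but it has no nonzero
      \<open>x\<close> and \<open>y\<close> to work with. Its only ideal is zero, so both chain
      conditions hold outright.\<close>
    case True
    have "I = {\<zero>}" if "ideal I R" for I
      using that additive_subgroup.a_subset additive_subgroup.zero_closed ideal.axioms(1) one_zeroD[OF True]
      by (metis empty_iff subset_singletonD)
    then have trivial: "f n = f 0" if "\<forall>n. f n \<in> {I. ideal I R}" for f :: "nat \<Rightarrow> 'a set" and n
      using that by (metis mem_Collect_eq)
    have "acc_on {I. ideal I R}" "dcc_on {I. ideal I R}"
      unfolding acc_on_def dcc_on_def using trivial by blast+
    then show ?thesis
      by blast
  next
    case False
    \<comment> \<open>With \<open>\<one> \<noteq> \<zero>\<close>, a commutative ring can fail to be
      a domain only through a pair of nonzero zero divisors.\<close>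
    then obtain x y where xy: "x \<in> carrier R" "y \<in> carrier R" "x \<otimes> y = \<zero>" "x \<noteq> \<zero>" "y \<noteq> \<zero>"
      using assms domain.intro[OF is_cring] unfolding domain_axioms_def by metis
    let ?g = "\<lambda>I. I \<inter> {z \<in> carrier R. x \<otimes> z = \<zero>}" and ?h = "\<lambda>I. (\<lambda>z. x \<otimes> z) ` I"
    have g: "?g I \<in> annihilating_ideals R" if "I \<in> {I. ideal I R}" for I
    proof (rule annihilating_idealsI[of _ x])
      show "ideal (?g I) R"
        using that xy(1) by (simp add: i_intersect ideal_element_annihilator)
    qed (use xy in \<open>auto simp: m_comm\<close>)
    have h: "?h I \<in> annihilating_ideals R" if "I \<in> {I. ideal I R}" for I
    proof (rule annihilating_idealsI[of _ y])
      fix i assume "i \<in> ?h I"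
      then obtain u where u: "u \<in> carrier R" "i = x \<otimes> u"
        using \<open>I \<in> {I. ideal I R}\<close> by (auto dest: ideal.Icarr)
      then have "i \<otimes> y = u \<otimes> (x \<otimes> y)"
        using xy by (simp add: m_ac)
      then show "i \<otimes> y = \<zero>"
        using xy u by simp
    next
      show "ideal (?h I) R"
        using that xy(1) by (simp add: ideal_mult_image)
    qed (use xy in auto)
    have mono: "mono_on {I. ideal I R} ?g" "mono_on {I. ideal I R} ?h"
      by (auto simp: mono_on_def)
    have inj: "I = J"
      if "I \<in> {I. ideal I R}" "J \<in> {I. ideal I R}" "I \<subseteq> J" "?g I = ?g J" "?h I = ?h J" for I J
      by (rule ideal_eq_if_annihilator_part_and_multiple_eq[OF _ _ _ xy(1)]) (use that in simp_all)
    show ?thesis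
    proof (intro conjI impI)
      show "acc_on {I. ideal I R}" if "acc_on (annihilating_ideals R)"
        by (rule acc_on_jointly_injective[OF that g mono(1) h mono(2) inj])
      show "dcc_on {I. ideal I R}" if "dcc_on (annihilating_ideals R)"
        by (rule dcc_on_jointly_injective[OF that g mono(1) h mono(2) inj])
    qed
  qed
  then show "acc_on (annihilating_ideals R) \<Longrightarrow> acc_on {I. ideal I R}"
    and "dcc_on (annihilating_ideals R) \<Longrightarrow> dcc_on {I. ideal I R}"
    by blast+
qed

end

theorem theorem1p1:
  fixes R :: "('a, 'b) ring_scheme"
  assumes "cring R" and "\<not> domain R"
  shows "(acc_on_vertices (annihilating_ideal_graph R) \<longleftrightarrow> noetherian_ring R) \<and>
         (dcc_on_vertices (annihilating_ideal_graph R) \<longleftrightarrow> artinian_ring R)"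
proof -
  interpret cring R by fact
  let ?A = "annihilating_ideals R"
  have verts: "pverts (annihilating_ideal_graph R) = ?A - {{\<zero>\<^bsub>R\<^esub>}}"
    by (simp add: annihilating_ideal_graph_def Let_def)
  have sub: "?A \<subseteq> {I. ideal I R}"
    by (auto simp: annihilating_ideals_def)
  have least: "{\<zero>\<^bsub>R\<^esub>} \<subseteq> I" if "I \<in> ?A" for I
    using that by (simp add: annihilating_ideals_def additive_subgroup.zero_closed ideal.axioms(1))
  \<comment> \<open>From left to right, the zero ideal is put back and the condition is then lifted
    from annihilating ideals to all ideals; the converse is restriction to a subset.\<close>
  have "acc_on (?A - {{\<zero>\<^bsub>R\<^esub>}}) \<longleftrightarrow> acc_on {I. ideal I R}"
    using acc_on_remove_least[OF _ least] chain_conditions_on_ideals_if_not_domain(1)[OF assms(2)]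
      acc_on_subset[of _ "?A - {{\<zero>\<^bsub>R\<^esub>}}"] sub by blast
  moreover have "dcc_on (?A - {{\<zero>\<^bsub>R\<^esub>}}) \<longleftrightarrow> dcc_on {I. ideal I R}"
    using dcc_on_remove_least[OF _ least] chain_conditions_on_ideals_if_not_domain(2)[OF assms(2)]
      dcc_on_subset[of _ "?A - {{\<zero>\<^bsub>R\<^esub>}}"] sub by blast
  moreover have "acc_on {I. ideal I R} \<longleftrightarrow> noetherian_ring R"
    using noetherian_ring_if_acc_on_ideals noetherian_ring.acc_on_ideals by blast
  moreover have "dcc_on {I. ideal I R} \<longleftrightarrow> artinian_ring R"
    using is_cring artinian_ring.intro artinian_ring_axioms.intro artinian_ring.dcc_on_ideals by blast
  ultimately show ?thesis
    unfolding acc_on_vertices_def dcc_on_vertices_def verts by simp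
qed

end
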